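(* Suppose that $(A,B)$ and $(C,D)$ are equivalent symmetric near-factorizations of $\mathbb{Z}_{2n}$, where $n$ is odd. Let $(A',B')$ and $(C',D')$ be obtained from $(A,B)$ and $(C,D)$, respectively, by applying the Pêcher transform. Then $(A',B')$ and $(C',D')$ are equivalent strongly symmetric near-factorizations of $D_n$.
   Context: For $n>2$, $D_n = \langle a,b : a^2 = b^n = abab = e\rangle$ is the dihedral group of order $2n$, with elements $a^ib^j$, $i\in\{0,1\}$, $0\le j\le n-1$ (exponents of $b$ modulo $n$). A near-factorization of a finite multiplicative group $G$ with identity $e$ is a pair $(A,B)$ of subsets with $|A|\cdot|B|=|G|-1$ and $AB=\{gh: g\in A,h\in B\}=G\setminus\{e\}$; for an additive group the second condition is $A+B=G\setminus\{0\}$. Two near-factorizations $(A,B)$, $(A_1,B_1)$ of $G$ are equivalent if $(A_1,B_1)=(f(A)h,\,h^{-1}f(B))$ for some $f\in\mathrm{Aut}(G)$, $h\in G$ (additively: $(f(A)+h,\,-h+f(B))$; for $\mathbb{Z}_m$ this means $A_1=rA+h$, $B_1=rB-h$ with $r$ a unit modulo $m$ and $h\in\mathbb{Z}_m$). A subset $X$ of an additive group is symmetric if $X=-X$, and $(A,B)$ is symmetric if both $A$ and $B$ are. A subset $X\subseteq D_n$ is strongly symmetric if $a^ib^j\in X \iff a^ib^{-j}\in X$ for $i=0,1$ and all $j$; a near-factorization $(A,B)$ of $D_n$ is strongly symmetric if both $A$ and $B$ are. Pêcher transform ($n$ odd): let $\phi:\mathbb{Z}_{2n}\to\mathbb{Z}_2\times\mathbb{Z}_n$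 be the group isomorphism $\phi(x)=(x \bmod 2, x\bmod n)$ and $\psi:\mathbb{Z}_2\times\mathbb{Z}_n\to D_n$ the bijection $\psi(i,j)=a^ib^j$; the Pêcher transform of a pair $(A,B)$ of subsets of $\mathbb{Z}_{2n}$ is $(\psi(\phi(A)),\psi(\phi(B)))$. *)

theory Defs
  imports "HOL-Algebra.Algebra"
begin

section \<open>Near-factorizations of a finite group\<close>

text \<open>The additive groups \<open>\<int>\<^sub>m\<close> are \<^const>\<open>integer_mod_group\<close> \<open>m\<close>, so the definitions below,
  written multiplicatively, cover the additive case as well.\<close>

definition near_factorization :: "('g, 'm) monoid_scheme \<Rightarrow> 'g set \<times> 'g set \<Rightarrow> bool" where
  "near_factorization G = (\<lambda>(A, B).
     finite (carrier G) \<and> A \<subseteq> carrier G \<and> B \<subseteq> carrier G \<and>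
     card A * card B = order G - 1 \<and>
     A <#>\<^bsub>G\<^esub> B = carrier G - {\<one>\<^bsub>G\<^esub>})"

definition equivalent_nf ::
    "('g, 'm) monoid_scheme \<Rightarrow> 'g set \<times> 'g set \<Rightarrow> 'g set \<times> 'g set \<Rightarrow> bool" where
  "equivalent_nf G = (\<lambda>(A, B) (A1, B1).
     \<exists>f \<in> auto G. \<exists>h \<in> carrier G.
       A1 = (f ` A) #>\<^bsub>G\<^esub> h \<and> B1 = (inv\<^bsub>G\<^esub> h) <#\<^bsub>G\<^esub> (f ` B))"

definition symmetric_subset :: "('g, 'm) monoid_scheme \<Rightarrow> 'g set \<Rightarrow> bool" where
  "symmetric_subset G S \<longleftrightarrow> S \<subseteq> carrier G \<and> S = set_inv\<^bsub>G\<^esub> S"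

definition symmetric_nf :: "('g, 'm) monoid_scheme \<Rightarrow> 'g set \<times> 'g set \<Rightarrow> bool" where
  "symmetric_nf G = (\<lambda>(A, B).
     near_factorization G (A, B) \<and> symmetric_subset G A \<and> symmetric_subset G B)"

section \<open>Dihedral groups\<close>

text \<open>The pair \<open>(i, j)\<close> with \<open>0 \<le> i < 2\<close>, \<open>0 \<le> j < n\<close> is the normal form \<open>a\<^sup>i b\<^sup>j\<close>.  The relation
  \<open>abab = e\<close> gives \<open>ba = ab\<^sup>-\<^sup>1\<close>, hence \<open>b\<^sup>j a = a b\<^sup>-\<^sup>j\<close>, which is the multiplication rule.
  The lemmas \<open>dihedral_relations\<close>, \<open>generate_dihedral\<close> and \<open>dihedral_universal\<close> show that this
  is the group presented by \<open>a\<^sup>2 = b\<^sup>n = abab = e\<close>.\<close>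

definition dihedral_group :: "nat \<Rightarrow> (int \<times> int) monoid" where
  "dihedral_group n =
     \<lparr>carrier = {0..<2} \<times> {0..<int n},
      monoid.mult = (\<lambda>(i, j) (k, l). ((i + k) mod 2, ((if k = 0 then j else - j) + l) mod int n)),
      one = (0, 0)\<rparr>"

definition dih_a :: "int \<times> int" where "dih_a = (1, 0)"

definition dih_b :: "int \<times> int" where "dih_b = (0, 1)"

definition dih_elem :: "nat \<Rightarrow> int \<Rightarrow> int \<Rightarrow> int \<times> int" where
  "dih_elem n i j =
     (dih_a [^]\<^bsub>dihedral_group n\<^esub> i) \<otimes>\<^bsub>dihedral_group n\<^esub> (dih_b [^]\<^bsub>dihedral_group n\<^esub> j)"

definition strongly_symmetric :: "nat \<Rightarrow> (int \<times> int) set \<Rightarrow> bool" where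
  "strongly_symmetric n S \<longleftrightarrow> S \<subseteq> carrier (dihedral_group n) \<and>
     (\<forall>i\<in>{0, 1}. \<forall>j. dih_elem n i j \<in> S \<longleftrightarrow> dih_elem n i (- j) \<in> S)"

definition strongly_symmetric_nf :: "nat \<Rightarrow> (int \<times> int) set \<times> (int \<times> int) set \<Rightarrow> bool" where
  "strongly_symmetric_nf n = (\<lambda>(A, B).
     near_factorization (dihedral_group n) (A, B) \<and>
     strongly_symmetric n A \<and> strongly_symmetric n B)"

section \<open>The Pecher transform\<close>

definition pecher_phi :: "nat \<Rightarrow> int \<Rightarrow> int \<times> int" where
  "pecher_phi n x = (x mod 2, x mod int n)"

definition pecher_psi :: "nat \<Rightarrow> int \<times> int \<Rightarrow> int \<times> int" where
  "pecher_psi n = (\<lambda>(i, j). dih_elem n i j)"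

definition pecher_transform ::
    "nat \<Rightarrow> int set \<times> int set \<Rightarrow> (int \<times> int) set \<times> (int \<times> int) set" where
  "pecher_transform n = (\<lambda>(A, B).
     (pecher_psi n ` pecher_phi n ` A, pecher_psi n ` pecher_phi n ` B))"

section \<open>Basic facts\<close>

lemma carrier_dihedral: "carrier (dihedral_group n) = {0..<2} \<times> {0..<int n}"
  by (simp add: dihedral_group_def)

lemma one_dihedral [simp]: "\<one>\<^bsub>dihedral_group n\<^esub> = (0, 0)"
  by (simp add: dihedral_group_def)

lemma mult_dihedral [simp]:
  "(i, j) \<otimes>\<^bsub>dihedral_group n\<^esub> (k, l) =
     ((i + k) mod 2, ((if k = 0 then j else - j) + l) mod int n)"
  by (simp add: dihedral_group_def)

lemma order_dihedral: "order (dihedral_group n) = 2 * n"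
  by (simp add: order_def carrier_dihedral card_cartesian_product)

lemma dihedral_cases:
  assumes "x \<in> carrier (dihedral_group n)"
  obtains i j where "x = (i, j)" "i = 0 \<or> i = 1" "0 \<le> j" "j < int n"
proof -
  obtain i j where "x = (i, j)" "0 \<le> i" "i < 2" "0 \<le> j" "j < int n"
    using assms by (auto simp: carrier_dihedral)
  with that[of i j] show ?thesis by linarith
qed

lemma group_dihedral: assumes "n > 0" shows "group (dihedral_group n)"
proof (rule groupI)
  fix x y z
  assume "x \<in> carrier (dihedral_group n)" "y \<in> carrier (dihedral_group n)"
    "z \<in> carrier (dihedral_group n)"
  then obtain i j k l p q where xyz: "x = (i, j)" "y = (k, l)" "z = (p, q)"
    and *: "i = 0 \<or> i = 1" "k = 0 \<or> k = 1" "p = 0 \<or> p = 1"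
    by (metis dihedral_cases)
  show "x \<otimes>\<^bsub>dihedral_group n\<^esub> y \<otimes>\<^bsub>dihedral_group n\<^esub> z =
        x \<otimes>\<^bsub>dihedral_group n\<^esub> (y \<otimes>\<^bsub>dihedral_group n\<^esub> z)"
    using * unfolding xyz by (elim disjE) (simp_all add: mod_simps algebra_simps)
next
  fix x assume "x \<in> carrier (dihedral_group n)"
  then obtain i j where x: "x = (i, j)" "i = 0 \<or> i = 1" "0 \<le> j" "j < int n"
    by (rule dihedral_cases)
  show "\<exists>y\<in>carrier (dihedral_group n). y \<otimes>\<^bsub>dihedral_group n\<^esub> x = \<one>\<^bsub>dihedral_group n\<^esub>"
    by (rule bexI[of _ "(i, if i = 0 then (- j) mod int n else j)"])
       (use x assms in \<open>auto simp: carrier_dihedral mod_simps\<close>)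
qed (use assms in \<open>auto simp: carrier_dihedral\<close>)

lemma dih_a_closed [simp]: "n > 0 \<Longrightarrow> dih_a \<in> carrier (dihedral_group n)"
  by (simp add: dih_a_def carrier_dihedral)

lemma dih_b_closed [simp]: "n > 1 \<Longrightarrow> dih_b \<in> carrier (dihedral_group n)"
  by (simp add: dih_b_def carrier_dihedral)

lemma dih_b_nat_pow: "dih_b [^]\<^bsub>dihedral_group n\<^esub> (k::nat) = (0, int k mod int n)"
  by (induction k) (auto simp: dih_b_def mod_simps add.commute)

lemma dih_a_nat_pow: "dih_a [^]\<^bsub>dihedral_group n\<^esub> (k::nat) = (int k mod 2, 0)"
  by (induction k) (auto simp: dih_a_def mod_simps add.commute)

lemma dih_elem_eq:
  assumes "n > 1" shows "dih_elem n i j = (i mod 2, j mod int n)"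
proof -
  interpret group "dihedral_group n" using assms by (simp add: group_dihedral)
  have red: "x [^]\<^bsub>dihedral_group n\<^esub> k = x [^]\<^bsub>dihedral_group n\<^esub> nat (k mod int m)"
    if x: "x \<in> carrier (dihedral_group n)" and m: "m > 0"
      and xm: "x [^]\<^bsub>dihedral_group n\<^esub> m = \<one>\<^bsub>dihedral_group n\<^esub>"
    for x m and k :: int
  proof -
    have "x [^]\<^bsub>dihedral_group n\<^esub> k
        = x [^]\<^bsub>dihedral_group n\<^esub> (int m * (k div int m) + k mod int m)" by simp
    also have "\<dots> = (x [^]\<^bsub>dihedral_group n\<^esub> int m) [^]\<^bsub>dihedral_group n\<^esub> (k div int m)
        \<otimes>\<^bsub>dihedral_group n\<^esub> x [^]\<^bsub>dihedral_group n\<^esub> (k mod int m)"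
      using x by (simp only: int_pow_mult int_pow_pow)
    also have "x [^]\<^bsub>dihedral_group n\<^esub> int m = \<one>\<^bsub>dihedral_group n\<^esub>"
      using xm by (simp only: int_pow_int)
    also have "\<one>\<^bsub>dihedral_group n\<^esub> [^]\<^bsub>dihedral_group n\<^esub> (k div int m)
        \<otimes>\<^bsub>dihedral_group n\<^esub> x [^]\<^bsub>dihedral_group n\<^esub> (k mod int m)
        = x [^]\<^bsub>dihedral_group n\<^esub> (k mod int m)"
      using x by (simp only: int_pow_one l_one int_pow_closed)
    also have "\<dots> = x [^]\<^bsub>dihedral_group n\<^esub> int (nat (k mod int m))" using m by simp
    finally show ?thesis by (simp only: int_pow_int)
  qed
  have a: "dih_a [^]\<^bsub>dihedral_group n\<^esub> i = (i mod 2, 0)"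
    using red[of dih_a 2 i] assms by (simp add: dih_a_nat_pow)
  have b: "dih_b [^]\<^bsub>dihedral_group n\<^esub> j = (0, j mod int n)"
    using red[of dih_b n j] assms by (simp add: dih_b_nat_pow)
  show ?thesis unfolding dih_elem_def a b by simp
qed

lemma dihedral_relations:
  assumes "n > 1"
  shows "dih_a [^]\<^bsub>dihedral_group n\<^esub> (2::nat) = \<one>\<^bsub>dihedral_group n\<^esub>"
    and "dih_b [^]\<^bsub>dihedral_group n\<^esub> n = \<one>\<^bsub>dihedral_group n\<^esub>"
    and "dih_a \<otimes>\<^bsub>dihedral_group n\<^esub> dih_b \<otimes>\<^bsub>dihedral_group n\<^esub> dih_a \<otimes>\<^bsub>dihedral_group n\<^esub> dih_b
           = \<one>\<^bsub>dihedral_group n\<^esub>"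
  using assms by (simp add: dih_a_nat_pow, simp add: dih_b_nat_pow,
    simp add: dih_a_def dih_b_def mod_simps)

lemma generate_dihedral:
  assumes "n > 1"
  shows "generate (dihedral_group n) {dih_a, dih_b} = carrier (dihedral_group n)"
proof -
  interpret group "dihedral_group n" using assms by (simp add: group_dihedral)
  have sub: "{dih_a, dih_b} \<subseteq> carrier (dihedral_group n)" using assms by simp
  interpret S: subgroup "generate (dihedral_group n) {dih_a, dih_b}" "dihedral_group n"
    by (rule generate_is_subgroup[OF sub])
  have gens: "dih_a \<in> generate (dihedral_group n) {dih_a, dih_b}"
    "dih_b \<in> generate (dihedral_group n) {dih_a, dih_b}"
    by (auto intro: generate.incl)
  have "x \<in> generate (dihedral_group n) {dih_a, dih_b}" if x_in: "x \<in> carrier (dihedral_group n)" for x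
  proof -
    obtain i j where x: "x = (i, j)" "i mod 2 = i" "j mod int n = j"
      using x_in by (cases x) (auto simp: carrier_dihedral)
    then have "x = dih_elem n i j" using assms by (simp add: dih_elem_eq)
    then show ?thesis
      unfolding dih_elem_def
      using gens by (simp add: S.m_closed subgroup_int_pow_closed[OF S.subgroup_axioms])
  qed
  then show ?thesis using S.subset by blast
qed

lemma dihedral_universal:
  assumes "n > 1" "group H" and xy: "x \<in> carrier H" "y \<in> carrier H"
    and rel: "x [^]\<^bsub>H\<^esub> (2::nat) = \<one>\<^bsub>H\<^esub>" "y [^]\<^bsub>H\<^esub> n = \<one>\<^bsub>H\<^esub>"
      "x \<otimes>\<^bsub>H\<^esub> y \<otimes>\<^bsub>H\<^esub> x \<otimes>\<^bsub>H\<^esub> y = \<one>\<^bsub>H\<^esub>"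
  shows "\<exists>h \<in> hom (dihedral_group n) H. h dih_a = x \<and> h dih_b = y"
proof -
  interpret H: group H by fact
  let ?h = "\<lambda>(i::int, j::int). x [^]\<^bsub>H\<^esub> i \<otimes>\<^bsub>H\<^esub> y [^]\<^bsub>H\<^esub> j"
  have xx: "x \<otimes>\<^bsub>H\<^esub> x = \<one>\<^bsub>H\<^esub>" using rel(1) xy by (simp add: numeral_2_eq_2)
  have ymod: "y [^]\<^bsub>H\<^esub> (j mod int n) = y [^]\<^bsub>H\<^esub> j" for j :: int
  proof -
    have "y [^]\<^bsub>H\<^esub> j = y [^]\<^bsub>H\<^esub> (int n * (j div int n) + j mod int n)" by simp
    also have "\<dots> = (y [^]\<^bsub>H\<^esub> int n) [^]\<^bsub>H\<^esub> (j div int n) \<otimes>\<^bsub>H\<^esub> y [^]\<^bsub>H\<^esub> (j mod int n)"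
      using xy by (simp only: H.int_pow_mult H.int_pow_pow)
    also have "\<dots> = y [^]\<^bsub>H\<^esub> (j mod int n)"
      using xy rel(2) by (simp add: int_pow_int)
    finally show ?thesis by simp
  qed
  have inv_x: "inv\<^bsub>H\<^esub> x = x" using xx xy by (simp add: H.inv_equality)
  have conj: "x \<otimes>\<^bsub>H\<^esub> y \<otimes>\<^bsub>H\<^esub> x = inv\<^bsub>H\<^esub> y"
    using rel(3) xy by (metis H.inv_equality H.m_closed)
  have conjn: "x \<otimes>\<^bsub>H\<^esub> y [^]\<^bsub>H\<^esub> k \<otimes>\<^bsub>H\<^esub> x = inv\<^bsub>H\<^esub> (y [^]\<^bsub>H\<^esub> k)" for k :: nat
  proof (induction k)
    case (Suc k)
    have "x \<otimes>\<^bsub>H\<^esub> y [^]\<^bsub>H\<^esub> Suc k \<otimes>\<^bsub>H\<^esub> x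
        = (x \<otimes>\<^bsub>H\<^esub> y [^]\<^bsub>H\<^esub> k \<otimes>\<^bsub>H\<^esub> x) \<otimes>\<^bsub>H\<^esub> (x \<otimes>\<^bsub>H\<^esub> y \<otimes>\<^bsub>H\<^esub> x)"
      using xy xx by (simp add: H.m_assoc) (metis H.m_assoc H.l_one H.m_closed)
    also have "\<dots> = inv\<^bsub>H\<^esub> (y \<otimes>\<^bsub>H\<^esub> y [^]\<^bsub>H\<^esub> k)"
      using xy by (simp add: Suc conj H.inv_mult_group)
    finally show ?case using xy by (simp flip: H.nat_pow_Suc2)
  qed (use xx xy in simp)
  have conji: "y [^]\<^bsub>H\<^esub> j \<otimes>\<^bsub>H\<^esub> x = x \<otimes>\<^bsub>H\<^esub> y [^]\<^bsub>H\<^esub> (- j)" for j :: int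
  proof -
    define k where "k = nat (j mod int n)"
    have k: "int k = j mod int n" using assms(1) by (simp add: k_def)
    have 1: "y [^]\<^bsub>H\<^esub> j = y [^]\<^bsub>H\<^esub> k" by (metis ymod k int_pow_int)
    have 2: "y [^]\<^bsub>H\<^esub> (- j) = inv\<^bsub>H\<^esub> (y [^]\<^bsub>H\<^esub> k)" using xy 1 by (simp add: H.int_pow_neg)
    have "x \<otimes>\<^bsub>H\<^esub> (x \<otimes>\<^bsub>H\<^esub> y [^]\<^bsub>H\<^esub> k \<otimes>\<^bsub>H\<^esub> x) = y [^]\<^bsub>H\<^esub> k \<otimes>\<^bsub>H\<^esub> x"
      using xy xx by (metis H.m_assoc H.l_one H.m_closed H.nat_pow_closed)
    then show ?thesis by (simp add: 1 2 conjn)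
  qed
  have "?h \<in> hom (dihedral_group n) H"
  proof (rule homI)
    fix u v assume "u \<in> carrier (dihedral_group n)" "v \<in> carrier (dihedral_group n)"
    then obtain i j k l where uv: "u = (i, j)" "v = (k, l)" and
      *: "i = 0 \<or> i = 1" "k = 0 \<or> k = 1"
      by (metis dihedral_cases)
    have yl: "y [^]\<^bsub>H\<^esub> (s + l) = y [^]\<^bsub>H\<^esub> s \<otimes>\<^bsub>H\<^esub> y [^]\<^bsub>H\<^esub> l" for s
      using xy by (simp add: H.int_pow_mult)
    have A: "y [^]\<^bsub>H\<^esub> j \<otimes>\<^bsub>H\<^esub> (x \<otimes>\<^bsub>H\<^esub> y [^]\<^bsub>H\<^esub> l)
        = x \<otimes>\<^bsub>H\<^esub> (y [^]\<^bsub>H\<^esub> (- j) \<otimes>\<^bsub>H\<^esub> y [^]\<^bsub>H\<^esub> l)"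
      using xy conji[of j] by (simp flip: H.m_assoc)
    have B: "x \<otimes>\<^bsub>H\<^esub> (x \<otimes>\<^bsub>H\<^esub> z) = z" if "z \<in> carrier H" for z
      using xy xx that by (simp flip: H.m_assoc)
    have yd: "y [^]\<^bsub>H\<^esub> (l - j) = y [^]\<^bsub>H\<^esub> (- j) \<otimes>\<^bsub>H\<^esub> y [^]\<^bsub>H\<^esub> l"
      using yl[of "- j"] by simp
    show "?h (u \<otimes>\<^bsub>dihedral_group n\<^esub> v) = ?h u \<otimes>\<^bsub>H\<^esub> ?h v"
      using * xy unfolding uv
      by (elim disjE) (simp_all add: ymod yl yd H.m_assoc A B H.int_pow_1)
  qed (use xy in auto)
  moreover have "?h dih_a = x" "?h dih_b = y"
    using xy by (simp_all add: dih_a_def dih_b_def H.int_pow_1)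
  ultimately show ?thesis by blast
qed

lemma pecher_psi_bij:
  assumes "n > 1"
  shows "bij_betw (pecher_psi n)
           (carrier (integer_mod_group 2 \<times>\<times> integer_mod_group n)) (carrier (dihedral_group n))"
proof -
  have "pecher_psi n z = z" if "z \<in> carrier (dihedral_group n)" for z
    using that assms by (auto simp: pecher_psi_def dih_elem_eq carrier_dihedral)
  moreover have "carrier (integer_mod_group 2 \<times>\<times> integer_mod_group n) = carrier (dihedral_group n)"
    using assms by (simp add: carrier_dihedral carrier_integer_mod_group)
  ultimately show ?thesis by (simp add: bij_betw_def inj_on_def)
qed

lemma pecher_phi_iso:
  assumes "odd n"
  shows "pecher_phi n \<in>
    iso (integer_mod_group (2 * n)) (integer_mod_group 2 \<times>\<times> integer_mod_group n)"
proof -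
  let ?G = "integer_mod_group (2 * n)" and ?H = "integer_mod_group 2 \<times>\<times> integer_mod_group n"
  have n: "n > 0" using assms by (simp add: odd_pos)
  have hom: "pecher_phi n \<in> hom ?G ?H"
    using n by (auto simp: hom_def pecher_phi_def carrier_integer_mod_group mod_simps
        mod_mod_cancel)
  have inj: "inj_on (pecher_phi n) (carrier ?G)"
  proof (rule inj_onI)
    fix x y assume xy: "x \<in> carrier ?G" "y \<in> carrier ?G" "pecher_phi n x = pecher_phi n y"
    have "2 dvd x - y" "int n dvd x - y"
      using xy(3) by (auto simp: pecher_phi_def mod_eq_dvd_iff)
    then have "2 * int n dvd x - y"
      using assms by (intro divides_mult) (auto simp: coprime_left_2_iff_odd)
    then have "x mod (2 * int n) = y mod (2 * int n)" by (simp add: mod_eq_dvd_iff)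
    then show "x = y" using xy(1,2) n by (simp add: carrier_integer_mod_group)
  qed
  have "pecher_phi n ` carrier ?G = carrier ?H"
  proof (rule card_subset_eq)
    show "finite (carrier ?H)" using n by (simp add: carrier_integer_mod_group)
    show "pecher_phi n ` carrier ?G \<subseteq> carrier ?H" using hom by (rule hom_carrier)
    show "card (pecher_phi n ` carrier ?G) = card (carrier ?H)"
      unfolding card_image[OF inj]
      using n by (simp add: carrier_integer_mod_group card_cartesian_product)
  qed
  with hom inj show ?thesis by (simp add: iso_def bij_betw_def)
qed

end

theory Submission
  imports Defs
begin

text \<open>The Pecher transform is multiplicative up to signs: the product of the images of \<open>x\<close> and \<open>y\<close>
  is the image of \<open>\<plusminus>x + y\<close>, the sign depending on the parity of \<open>y\<close>. Symmetry of the first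
  factor absorbs the sign, so images of symmetric near-factorizations are near-factorizations.
  If \<open>C = rA + h\<close> and \<open>D = rB - h\<close> with all four sets symmetric, then \<open>C + 2h = C\<close> and
  \<open>D - 2h = D\<close>; uniqueness of factorizations forces \<open>2h = 0\<close>. Hence \<open>h\<close> maps to \<open>e\<close> or to
  the reflection \<open>a\<close>, and the equivalence is realised in \<open>D\<^sub>n\<close> by the automorphism
  \<open>a\<^sup>i b\<^sup>j \<mapsto> a\<^sup>i b\<^sup>r\<^sup>j\<close> followed by translation by this image.\<close>

section \<open>Uniqueness of factorizations in near-factorizations\<close>

text \<open>Counting: multiplication maps \<open>A \<times> B\<close> onto the group without its
  identity, and both finite sets have \<open>order G - 1\<close> elements, so this surjection is
  injective.\<close>

lemma near_factorization_inj_on: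
  assumes "group G" and "near_factorization G (A, B)"
  shows "inj_on (\<lambda>(a, b). a \<otimes>\<^bsub>G\<^esub> b) (A \<times> B)"
proof -
  interpret group G by fact
  have fin: "finite (carrier G)" and sub: "A \<subseteq> carrier G" "B \<subseteq> carrier G"
    and card: "card A * card B = order G - 1"
    and prod: "A <#>\<^bsub>G\<^esub> B = carrier G - {\<one>\<^bsub>G\<^esub>}"
    using assms(2) by (auto simp: near_factorization_def)
  have "(\<lambda>(a, b). a \<otimes>\<^bsub>G\<^esub> b) ` (A \<times> B) = A <#>\<^bsub>G\<^esub> B"
    by (auto simp: set_mult_def)
  then have "card ((\<lambda>(a, b). a \<otimes>\<^bsub>G\<^esub> b) ` (A \<times> B)) = card (A \<times> B)"
    using fin card by (simp add: prod order_def card_cartesian_product)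
  moreover have "finite (A \<times> B)"
    using fin sub by (simp add: finite_subset)
  ultimately show ?thesis by (simp add: eq_card_imp_inj_on)
qed

text \<open>A shift by \<open>k\<close> that preserves both factors would factor the product of
  \<open>a\<close> and \<open>b\<close> a second time, as \<open>ak\<close> times the inverse of
  \<open>k\<close> times \<open>b\<close>. Uniqueness leaves only \<open>ak = a\<close>. The bound
  on the order supplies some \<open>a\<close> and \<open>b\<close>.\<close>

lemma near_factorization_stable_shift:
  assumes "group G" and nf: "near_factorization G (A, B)" and "order G > 1"
    and k: "k \<in> carrier G"
    and A: "\<And>a. a \<in> A \<Longrightarrow> a \<otimes>\<^bsub>G\<^esub> k \<in> A"
    and B: "\<And>b. b \<in> B \<Longrightarrow> inv\<^bsub>G\<^esub> k \<otimes>\<^bsub>G\<^esub> b \<in> B"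
  shows "k = \<one>\<^bsub>G\<^esub>"
proof -
  interpret group G by fact
  have sub: "A \<subseteq> carrier G" "B \<subseteq> carrier G" and "card A * card B > 0"
    using nf \<open>order G > 1\<close> by (auto simp: near_factorization_def)
  then obtain a b where ab: "a \<in> A" "b \<in> B"
    by (metis card.empty equals0I mult_is_0 less_numeral_extra(3))
  then have c: "a \<in> carrier G" "b \<in> carrier G" using sub by auto
  have "(a \<otimes>\<^bsub>G\<^esub> k) \<otimes>\<^bsub>G\<^esub> (inv\<^bsub>G\<^esub> k \<otimes>\<^bsub>G\<^esub> b) = a \<otimes>\<^bsub>G\<^esub> b"
    using c k by (simp add: m_assoc) (simp flip: m_assoc)
  then have "a \<otimes>\<^bsub>G\<^esub> k = a"
    using inj_onD[OF near_factorization_inj_on[OF assms(1,2)],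
        of "(a \<otimes>\<^bsub>G\<^esub> k, inv\<^bsub>G\<^esub> k \<otimes>\<^bsub>G\<^esub> b)" "(a, b)"] ab A B by auto
  then show ?thesis using c k by simp
qed

section \<open>Automorphisms of the cyclic and dihedral groups\<close>

text \<open>The group is generated by \<open>1\<close>, and \<open>x\<close> is the
  \<open>x\<close>-th power of \<open>1\<close>.\<close>

lemma hom_integer_mod_group_eq:
  assumes "m > 1" and f: "f \<in> hom (integer_mod_group m) (integer_mod_group m)"
    and x: "x \<in> {0..<int m}"
  shows "f x = f 1 * x mod int m"
proof -
  let ?Z = "integer_mod_group m"
  interpret group_hom ?Z ?Z f
    using f by (simp add: group_hom_def group_hom_axioms_def)
  have "f (1 [^]\<^bsub>?Z\<^esub> x) = f 1 [^]\<^bsub>?Z\<^esub> x"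
    using \<open>m > 1\<close> by (intro hom_int_pow) simp
  then show ?thesis using x by (simp add: int_pow_integer_mod_group mult.commute)
qed

lemma auto_integer_mod_group_eq:
  assumes "m > 1" and f: "f \<in> auto (integer_mod_group m)"
  obtains r where "coprime r (int m)"
    and "\<And>x. x \<in> {0..<int m} \<Longrightarrow> f x = r * x mod int m"
proof
  have hom: "f \<in> hom (integer_mod_group m) (integer_mod_group m)"
    and bij: "f ` {0..<int m} = {0..<int m}"
    using f \<open>m > 1\<close> by (auto simp: auto_def Bij_def bij_betw_def carrier_integer_mod_group)
  \<comment> \<open>This fixes the multiplier \<open>r\<close> as \<open>f 1\<close>. It is a unit
    because surjectivity of \<open>f\<close> provides an \<open>x\<close> with
    \<open>f 1 * x\<close> congruent to 1.\<close>
  show eq: "f x = f 1 * x mod int m" if "x \<in> {0..<int m}" for x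
    using hom_integer_mod_group_eq[OF \<open>m > 1\<close> hom] that by simp
  have "1 \<in> f ` {0..<int m}" using bij \<open>m > 1\<close> by simp
  then obtain x where "x \<in> {0..<int m}" "f x = 1" by auto
  then have 1: "f 1 * x mod int m = 1" using eq by simp
  show "coprime (f 1) (int m)"
  proof (rule coprimeI)
    fix c assume "c dvd f 1" "c dvd int m"
    then have "c dvd f 1 * x mod int m" by (simp add: dvd_mod_iff)
    then show "is_unit c" using 1 by simp
  qed
qed

text \<open>Scaling the exponent of \<open>b\<close> by \<open>r\<close> commutes with the sign in
  the dihedral product. The map is restricted to the carrier because members of \<open>auto\<close>
  must be extensional.\<close>

lemma dihedral_scale_auto:
  fixes r :: int
  assumes "n > 1" and "coprime r (int n)"
  shows "(\<lambda>(i, j)\<in>carrier (dihedral_group n). (i, r * j mod int n)) \<in> auto (dihedral_group n)"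
    (is "?F \<in> _")
proof -
  have closed: "?F x \<in> carrier (dihedral_group n)" if "x \<in> carrier (dihedral_group n)" for x
    using that \<open>n > 1\<close> by (auto simp: carrier_dihedral)
  have "?F (x \<otimes>\<^bsub>dihedral_group n\<^esub> y) = ?F x \<otimes>\<^bsub>dihedral_group n\<^esub> ?F y"
    if xy: "x \<in> carrier (dihedral_group n)" "y \<in> carrier (dihedral_group n)" for x y
  proof -
    obtain i j k l where [simp]: "x = (i, j)" "y = (k, l)" by (cases x, cases y) auto
    show ?thesis
      using xy \<open>n > 1\<close> by (simp add: carrier_dihedral mod_simps algebra_simps)
  qed
  then have hom: "?F \<in> hom (dihedral_group n) (dihedral_group n)"
    using closed by (auto simp: hom_def)
  have inj: "inj_on ?F (carrier (dihedral_group n))"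
  proof (rule inj_onI)
    fix x y assume xy: "x \<in> carrier (dihedral_group n)" "y \<in> carrier (dihedral_group n)"
      and eq: "?F x = ?F y"
    obtain i j k l where [simp]: "x = (i, j)" "y = (k, l)" by (cases x, cases y) auto
    have "i = k" "int n dvd r * (j - l)"
      using xy eq by (auto simp: mod_eq_dvd_iff right_diff_distrib)
    then have "j mod int n = l mod int n"
      using assms(2) by (simp add: mod_eq_dvd_iff coprime_dvd_mult_right_iff coprime_commute)
    then show "x = y" using \<open>i = k\<close> xy by (simp add: carrier_dihedral)
  qed
  \<comment> \<open>On a finite carrier, injectivity gives surjectivity.\<close>
  have "finite (carrier (dihedral_group n))" by (simp add: carrier_dihedral)
  then have "bij_betw ?F (carrier (dihedral_group n)) (carrier (dihedral_group n))"
    using inj closed by (metis bij_betw_def endo_inj_surj image_subsetI)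
  then show ?thesis using hom by (simp add: auto_def Bij_def)
qed

section \<open>The Pecher transform on products and symmetric sets\<close>

text \<open>Elements of the dihedral group are encoded as their reduced exponent pairs, so
  \<open>pecher_psi\<close> fixes every value of \<open>pecher_phi\<close>.\<close>

lemma pecher_transform_eq:
  assumes "n > 1"
  shows "pecher_transform n (A, B) = (pecher_phi n ` A, pecher_phi n ` B)"
proof -
  have "pecher_psi n (pecher_phi n x) = pecher_phi n x" for x
    using assms by (simp add: pecher_psi_def pecher_phi_def dih_elem_eq)
  then show ?thesis by (simp add: pecher_transform_def image_image)
qed

text \<open>Moving a power of \<open>b\<close> past \<open>a\<close> inverts it, so \<open>x\<close>
  changes sign modulo \<open>n\<close> exactly when \<open>y\<close> is odd. Modulo 2 a sign is
  invisible, hence the sign can be put on the integer \<open>x\<close> itself.\<close>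

lemma pecher_phi_mult:
  "pecher_phi n x \<otimes>\<^bsub>dihedral_group n\<^esub> pecher_phi n y
     = pecher_phi n ((if even y then x else - x) + y)"
proof (cases "even y")
  case True
  then have "y mod 2 = 0" by presburger
  then show ?thesis using True by (simp add: pecher_phi_def mod_add_eq) presburger
next
  case False
  then have "y mod 2 = 1" by presburger
  moreover from False have "(x mod 2 + 1) mod 2 = (- x + y) mod 2" by presburger
  moreover have "(- (x mod int n) + y mod int n) mod int n = (- x + y) mod int n"
    by (intro mod_add_cong mod_minus_cong) simp_all
  ultimately show ?thesis using False by (simp add: pecher_phi_def)
qed

lemma pecher_phi_mod [simp]: "pecher_phi n (x mod (2 * int n)) = pecher_phi n x"
  by (simp add: pecher_phi_def mod_mod_cancel)

lemma pecher_phi_mult_add_mod [simp]: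
  "pecher_phi n (r * (x mod (2 * int n)) + y) = pecher_phi n (r * x + y)"
proof -
  have "(r * (x mod (2 * int n)) + y) mod (2 * int n) = (r * x + y) mod (2 * int n)"
    by (intro mod_add_cong mod_mult_cong) simp_all
  then show ?thesis by (metis pecher_phi_mod)
qed

lemma pecher_phi_add_mod [simp]:
  "pecher_phi n (x mod (2 * int n) + y) = pecher_phi n (x + y)"
  using pecher_phi_mult_add_mod[of n 1 x y] by simp

lemma pecher_phi_bij:
  assumes "odd n"
  shows "bij_betw (pecher_phi n) {0..<2 * int n} (carrier (dihedral_group n))"
proof -
  have "n > 0" using assms by (simp add: odd_pos)
  then show ?thesis
    using pecher_phi_iso[OF assms]
    by (simp add: iso_def carrier_dihedral carrier_integer_mod_group)
qed

lemma set_inv_integer_mod_group: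
  assumes "S \<subseteq> carrier (integer_mod_group m)"
  shows "set_inv\<^bsub>integer_mod_group m\<^esub> S = (\<lambda>x. (- x) mod int m) ` S"
  using assms unfolding SET_INV_def UNION_singleton_eq_range by (auto intro!: image_cong)

lemma symmetric_subset_uminus_image:
  assumes "symmetric_subset (integer_mod_group m) S"
  shows "(\<lambda>x. (- x) mod int m) ` S = S"
  using assms set_inv_integer_mod_group[of S m] by (simp add: symmetric_subset_def)

lemma symmetric_subset_uminus:
  assumes "symmetric_subset (integer_mod_group m) S" and "x \<in> S"
  shows "(- x) mod int m \<in> S"
  using assms by (metis symmetric_subset_uminus_image image_eqI)

lemma symmetric_subset_integer_mod_group_mult:
  assumes "m > 0" and "symmetric_subset (integer_mod_group m) S"
  shows "symmetric_subset (integer_mod_group m) ((\<lambda>x. r * x mod int m) ` S)"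
proof -
  have sub: "(\<lambda>x. r * x mod int m) ` S \<subseteq> carrier (integer_mod_group m)"
    using \<open>m > 0\<close> by (auto simp: carrier_integer_mod_group)
  have "(- (r * x mod int m)) mod int m = r * ((- x) mod int m) mod int m" for x
    by (simp add: mod_minus_eq mod_mult_right_eq)
  then have "(\<lambda>x. (- x) mod int m) ` (\<lambda>x. r * x mod int m) ` S
      = (\<lambda>x. r * x mod int m) ` (\<lambda>x. (- x) mod int m) ` S"
    by (simp only: image_image)
  also have "\<dots> = (\<lambda>x. r * x mod int m) ` S"
    by (simp only: symmetric_subset_uminus_image[OF assms(2)])
  finally show ?thesis
    using sub by (simp add: symmetric_subset_def set_inv_integer_mod_group)
qed

text \<open>Negation modulo \<open>2 * n\<close> keeps the parity and negates the residue modulo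
  \<open>n\<close>, so under the transform it inverts the exponent of \<open>b\<close> and keeps
  that of \<open>a\<close>.\<close>

lemma pecher_phi_strongly_symmetric:
  assumes "n > 1" "odd n" and sym: "symmetric_subset (integer_mod_group (2 * n)) S"
  shows "strongly_symmetric n (pecher_phi n ` S)"
proof -
  have S: "S \<subseteq> {0..<2 * int n}" "\<And>x. x \<in> S \<Longrightarrow> (- x) mod (2 * int n) \<in> S"
    using sym \<open>n > 1\<close> symmetric_subset_uminus[OF sym]
    by (simp_all add: symmetric_subset_def carrier_integer_mod_group)
  have neg: "dih_elem n i (- j) \<in> pecher_phi n ` S"
    if "dih_elem n i j \<in> pecher_phi n ` S" for i j
  proof -
    obtain x where x: "x \<in> S" "i mod 2 = x mod 2" "j mod int n = x mod int n"
      using \<open>dih_elem n i j \<in> _\<close> \<open>n > 1\<close> by (auto simp: pecher_phi_def dih_elem_eq)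
    have "(- x) mod 2 = x mod 2" by presburger
    then have "dih_elem n i (- j) = pecher_phi n (- x)"
      unfolding dih_elem_eq[OF \<open>n > 1\<close>] pecher_phi_def
      using x(2) mod_minus_cong[OF x(3)] by simp
    then have "dih_elem n i (- j) = pecher_phi n ((- x) mod (2 * int n))" by simp
    then show ?thesis using S(2)[OF x(1)] by (metis image_eqI)
  qed
  have "pecher_phi n ` S \<subseteq> carrier (dihedral_group n)"
    using S(1) pecher_phi_bij[OF \<open>odd n\<close>] by (metis bij_betw_def image_mono)
  moreover have "dih_elem n i j \<in> pecher_phi n ` S \<longleftrightarrow> dih_elem n i (- j) \<in> pecher_phi n ` S" for i j
    using neg[of i j] neg[of i "- j"] by auto
  ultimately show ?thesis by (simp add: strongly_symmetric_def)
qed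

text \<open>For each fixed \<open>b\<close>, the sign in \<open>pecher_phi_mult\<close> only
  permutes the symmetric set \<open>A\<close>. The product of the images is therefore the image of
  the sumset.\<close>

lemma pecher_phi_near_factorization:
  assumes "odd n" and nf: "near_factorization (integer_mod_group (2 * n)) (A, B)"
    and sym: "symmetric_subset (integer_mod_group (2 * n)) A"
  shows "near_factorization (dihedral_group n) (pecher_phi n ` A, pecher_phi n ` B)"
proof -
  let ?Z = "integer_mod_group (2 * n)"
  have n: "n > 0" using \<open>odd n\<close> by (simp add: odd_pos)
  have carrier: "carrier ?Z = {0..<2 * int n}" using n by (simp add: carrier_integer_mod_group)
  have A: "A \<subseteq> {0..<2 * int n}" "\<And>x. x \<in> A \<Longrightarrow> (- x) mod (2 * int n) \<in> A"
    using sym n symmetric_subset_uminus[OF sym]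
    by (simp_all add: symmetric_subset_def carrier)
  have B: "B \<subseteq> {0..<2 * int n}" and card: "card A * card B = 2 * n - 1"
    and prod: "A <#>\<^bsub>?Z\<^esub> B = {0..<2 * int n} - {0}"
    using nf by (auto simp: near_factorization_def carrier order_def)
  have inj: "inj_on (pecher_phi n) {0..<2 * int n}"
    and img: "pecher_phi n ` {0..<2 * int n} = carrier (dihedral_group n)"
    using pecher_phi_bij[OF \<open>odd n\<close>] by (auto simp: bij_betw_def)
  have "pecher_phi n ` A <#>\<^bsub>dihedral_group n\<^esub> pecher_phi n ` B = pecher_phi n ` (A <#>\<^bsub>?Z\<^esub> B)"
  proof (intro equalityI subsetI)
    fix z assume "z \<in> pecher_phi n ` A <#>\<^bsub>dihedral_group n\<^esub> pecher_phi n ` B"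
    then obtain a b where ab: "a \<in> A" "b \<in> B"
      and z: "z = pecher_phi n ((if even b then a else - a) + b)"
      by (auto simp: set_mult_def pecher_phi_mult)
    let ?a = "if even b then a else (- a) mod (2 * int n)"
    have "z = pecher_phi n ((?a + b) mod (2 * int n))"
      unfolding z by simp
    moreover have "?a \<in> A" using ab A(2) by simp
    then have "(?a + b) mod (2 * int n) \<in> A <#>\<^bsub>?Z\<^esub> B"
      using ab(2) unfolding set_mult_def by fastforce
    ultimately show "z \<in> pecher_phi n ` (A <#>\<^bsub>?Z\<^esub> B)" by (rule image_eqI)
  next
    fix z assume "z \<in> pecher_phi n ` (A <#>\<^bsub>?Z\<^esub> B)"
    then obtain a b where ab: "a \<in> A" "b \<in> B" and z: "z = pecher_phi n (a + b)"
      by (auto simp: set_mult_def)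
    \<comment> \<open>Negating \<open>a\<close> in advance for odd \<open>b\<close> cancels the sign
      that the dihedral product introduces.\<close>
    let ?a = "if even b then a else (- a) mod (2 * int n)"
    have "pecher_phi n ?a \<otimes>\<^bsub>dihedral_group n\<^esub> pecher_phi n b = z"
      unfolding z pecher_phi_mult using pecher_phi_mult_add_mod[of n "- 1" "- a" b] by simp
    moreover have "?a \<in> A" using ab A(2) by simp
    ultimately show "z \<in> pecher_phi n ` A <#>\<^bsub>dihedral_group n\<^esub> pecher_phi n ` B"
      using ab(2) unfolding set_mult_def by blast
  qed
  \<comment> \<open>By injectivity, removing 0 before the transform amounts to removing its image,
    the identity, afterwards.\<close>
  also have "\<dots> = carrier (dihedral_group n) - {\<one>\<^bsub>dihedral_group n\<^esub>}"
    unfolding prod img[symmetric]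
    using inj_on_image_set_diff[OF inj, of "{0..<2 * int n}" "{0}"] n
    by (simp add: pecher_phi_def)
  finally have "pecher_phi n ` A <#>\<^bsub>dihedral_group n\<^esub> pecher_phi n ` B
    = carrier (dihedral_group n) - {\<one>\<^bsub>dihedral_group n\<^esub>}" .
  moreover have "card (pecher_phi n ` A) = card A" "card (pecher_phi n ` B) = card B"
    using A(1) B by (auto intro!: card_image inj_on_subset[OF inj])
  moreover have "pecher_phi n ` A \<subseteq> carrier (dihedral_group n)"
    "pecher_phi n ` B \<subseteq> carrier (dihedral_group n)"
    unfolding img[symmetric] using A(1) B by auto
  ultimately show ?thesis
    using card by (simp add: near_factorization_def order_dihedral)
      (simp add: carrier_dihedral)
qed

lemma pecher_phi_strongly_symmetric_nf:
  assumes "n > 1" "odd n" and "symmetric_nf (integer_mod_group (2 * n)) (A, B)"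
  shows "strongly_symmetric_nf n (pecher_phi n ` A, pecher_phi n ` B)"
  using assms pecher_phi_near_factorization pecher_phi_strongly_symmetric
  by (simp add: strongly_symmetric_nf_def symmetric_nf_def)

section \<open>Translations between symmetric near-factorizations\<close>

text \<open>Symmetry of \<open>S\<close> and of \<open>S + h\<close> gives
  \<open>S + h = S - h\<close>, so \<open>S + h\<close> is stable under adding \<open>2 * h\<close>.
  Likewise \<open>T - h\<close> is stable under subtracting it, and
  \<open>near_factorization_stable_shift\<close> applies with \<open>k = 2 * h\<close>.\<close>

lemma symmetric_nf_translation:
  fixes m :: nat
  assumes "m > 1"
    and S: "symmetric_subset (integer_mod_group m) S"
    and T: "symmetric_subset (integer_mod_group m) T"
    and C: "symmetric_nf (integer_mod_group m)
      ((\<lambda>x. (x + h) mod int m) ` S, (\<lambda>x. (x - h) mod int m) ` T)"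
  shows "2 * h mod int m = 0"
proof -
  let ?Z = "integer_mod_group m"
  let ?C = "(\<lambda>x. (x + h) mod int m) ` S" and ?D = "(\<lambda>x. (x - h) mod int m) ` T"
  have symC: "symmetric_subset ?Z ?C" and symD: "symmetric_subset ?Z ?D"
    using C by (simp_all add: symmetric_nf_def)
  have nf: "near_factorization ?Z (?C, ?D)" using C by (simp add: symmetric_nf_def)
  let ?k = "2 * h mod int m"
  have k: "?k \<in> carrier ?Z" using \<open>m > 1\<close> by (simp add: carrier_integer_mod_group)
  have inv: "inv\<^bsub>?Z\<^esub> ?k = (- (2 * h)) mod int m"
    using k by (simp add: mod_simps)
  have "c \<otimes>\<^bsub>?Z\<^esub> ?k \<in> ?C" if c: "c \<in> ?C" for c
  proof -
    obtain x where x: "x \<in> S" "(- c) mod int m = (x + h) mod int m"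
      using symmetric_subset_uminus[OF symC c] by auto
    have "c \<otimes>\<^bsub>?Z\<^esub> ?k = (- ((- c) mod int m) + 2 * h) mod int m"
      by (simp add: mod_simps add.commute)
    also have "\<dots> = ((- x) mod int m + h) mod int m"
      unfolding x(2) by (simp add: mod_simps algebra_simps)
    finally show ?thesis using symmetric_subset_uminus[OF S x(1)] by (rule image_eqI)
  qed
  moreover have "inv\<^bsub>?Z\<^esub> ?k \<otimes>\<^bsub>?Z\<^esub> d \<in> ?D" if d: "d \<in> ?D" for d
  proof -
    obtain x where x: "x \<in> T" "(- d) mod int m = (x - h) mod int m"
      using symmetric_subset_uminus[OF symD d] by auto
    have "inv\<^bsub>?Z\<^esub> ?k \<otimes>\<^bsub>?Z\<^esub> d = (- (2 * h) - ((- d) mod int m)) mod int m"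
      unfolding inv by (simp add: mod_simps)
    also have "\<dots> = ((- x) mod int m - h) mod int m"
      unfolding x(2) by (simp add: mod_simps) (metis minus_diff_commute)
    finally show ?thesis using symmetric_subset_uminus[OF T x(1)] by (rule image_eqI)
  qed
  ultimately have "?k = \<one>\<^bsub>?Z\<^esub>"
    using near_factorization_stable_shift[OF _ nf _ k] \<open>m > 1\<close>
    by (simp add: order_def carrier_integer_mod_group)
  then show ?thesis by simp
qed

theorem theorem3p7:
  fixes n :: nat
    and A B C D :: "int set"
    and A' B' C' D' :: "(int \<times> int) set"
  assumes "n > 2" and "odd n"
    and "symmetric_nf (integer_mod_group (2 * n)) (A, B)"
    and "symmetric_nf (integer_mod_group (2 * n)) (C, D)"
    and "equivalent_nf (integer_mod_group (2 * n)) (A, B) (C, D)"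
    and "(A', B') = pecher_transform n (A, B)"
    and "(C', D') = pecher_transform n (C, D)"
  shows "strongly_symmetric_nf n (A', B') \<and> strongly_symmetric_nf n (C', D') \<and>
    equivalent_nf (dihedral_group n) (A', B') (C', D')"
proof -
  let ?Z = "integer_mod_group (2 * n)" and ?G = "dihedral_group n" and ?m = "2 * int n"
  let ?p = "pecher_phi n"
  have n: "n > 1" using \<open>n > 2\<close> by simp
  interpret G: group ?G using n by (simp add: group_dihedral)
  have img: "A' = ?p ` A" "B' = ?p ` B" "C' = ?p ` C" "D' = ?p ` D"
    using assms(6,7) n by (simp_all add: pecher_transform_eq)
  have carrier: "carrier ?Z = {0..<?m}" using n by (simp add: carrier_integer_mod_group)
  have symA: "symmetric_subset ?Z A" and symB: "symmetric_subset ?Z B"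
    using assms(3) by (simp_all add: symmetric_nf_def)
  have sub: "A \<subseteq> {0..<?m}" "B \<subseteq> {0..<?m}"
    using symA symB unfolding symmetric_subset_def carrier by auto
  obtain f h where f: "f \<in> auto ?Z" and h: "h \<in> {0..<?m}"
    and CD: "C = (f ` A) #>\<^bsub>?Z\<^esub> h" "D = (inv\<^bsub>?Z\<^esub> h) <#\<^bsub>?Z\<^esub> (f ` B)"
    using assms(5) by (auto simp: equivalent_nf_def carrier)
  obtain r where r: "coprime r ?m" "\<And>x. x \<in> {0..<?m} \<Longrightarrow> f x = r * x mod ?m"
    using auto_integer_mod_group_eq[OF _ f] n by auto
  have fA: "f ` A = (\<lambda>x. r * x mod ?m) ` A" and fB: "f ` B = (\<lambda>x. r * x mod ?m) ` B"
    using r(2) sub by (auto intro!: image_cong)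
  have inv_h: "inv\<^bsub>?Z\<^esub> h = (- h) mod ?m"
    using h by (simp add: carrier)
  have C: "C = (\<lambda>x. (x + h) mod ?m) ` f ` A"
    unfolding CD r_coset_def by auto
  have D: "D = (\<lambda>x. (x - h) mod ?m) ` f ` B"
    unfolding CD l_coset_def inv_h by (auto simp: mod_simps algebra_simps)
  have "2 * h mod ?m = 0"
  proof -
    have "int (2 * n) = ?m" by simp
    then show ?thesis
      using symmetric_nf_translation[of "2 * n" "f ` A" "f ` B" h] assms(4) n
        symmetric_subset_integer_mod_group_mult[OF _ symA, of r]
        symmetric_subset_integer_mod_group_mult[OF _ symB, of r]
      unfolding C D fA fB by simp
  qed
  \<comment> \<open>Hence \<open>?p h\<close> is \<open>(h mod 2, 0)\<close>, the identity or the
    reflection \<open>a\<close>.\<close>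
  then have h2: "h mod int n = 0" by (simp add: mod_mult_mult1)
  have "odd r" "coprime r (int n)" using r(1) by auto
  define F where "F = (\<lambda>(i, j)\<in>carrier ?G. (i, r * j mod int n))"
  have F: "F \<in> auto ?G"
    unfolding F_def using dihedral_scale_auto[OF n \<open>coprime r (int n)\<close>] .
  \<comment> \<open>Oddness of \<open>r\<close> matters here: multiplication by \<open>r\<close>
    then preserves parity, in agreement with \<open>F\<close> fixing the first component.\<close>
  have Fp: "F (?p x) = ?p (r * x)" for x
    using n \<open>odd r\<close> by (simp add: F_def carrier_dihedral pecher_phi_def mod_simps)
      (metis mod_mult_left_eq mult_1 odd_iff_mod_2_eq_one)
  have ph: "?p h \<in> carrier ?G" using n by (simp add: pecher_phi_def carrier_dihedral)
  have p_add: "?p x \<otimes>\<^bsub>?G\<^esub> ?p h = ?p ((if even h then x else - x) + h)" for x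
    by (rule pecher_phi_mult)
  have p_inv: "inv\<^bsub>?G\<^esub> ?p h = ?p h"
  proof (rule G.inv_equality)
    have "(h + h) mod int n = 0" using h2 mod_add_eq[of h "int n" h] by simp
    moreover have "(h + h) mod 2 = 0" by presburger
    ultimately show "?p h \<otimes>\<^bsub>?G\<^esub> ?p h = \<one>\<^bsub>?G\<^esub>"
      unfolding pecher_phi_mult by (simp add: pecher_phi_def)
  qed (fact ph)+
  \<comment> \<open>As \<open>h\<close> vanishes modulo \<open>n\<close>, its sign is irrelevant in
    both components, so multiplication by \<open>?p h\<close> on the left can be written as
    subtraction of \<open>h\<close>.\<close>
  have p_sub: "?p h \<otimes>\<^bsub>?G\<^esub> ?p x = ?p (x - h)" for x
  proof -
    have "(- h + x) mod int n = (h + x) mod int n"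
      using h2 by (simp add: mod_eq_dvd_iff mod_eq_0_iff_dvd)
    moreover have "(h + x) mod 2 = (x - h) mod 2" by presburger
    ultimately have "?p ((if even x then h else - h) + x) = ?p (x - h)"
      by (simp add: pecher_phi_def)
    then show ?thesis by (simp add: pecher_phi_mult)
  qed
  have "C' = (\<lambda>x. ?p (r * x + h)) ` A"
    unfolding img C fA by (simp add: image_image mod_simps)
  \<comment> \<open>For odd \<open>h\<close>, multiplication by \<open>?p h\<close> on the right
    negates the other argument. Reindexing the symmetric set \<open>A\<close> by negation
    compensates for this.\<close>
  also have "\<dots> = (\<lambda>x. ?p (r * (if even h then x else - x) + h)) ` A"
  proof (cases "even h")
    case False
    have "(\<lambda>x. ?p (r * x + h)) ` A = (\<lambda>x. ?p (r * x + h)) ` (\<lambda>x. (- x) mod ?m) ` A"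
      using symmetric_subset_uminus_image[OF symA] by simp
    then show ?thesis using False by (simp add: image_image)
  qed simp
  also have "\<dots> = (F ` A') #>\<^bsub>?G\<^esub> ?p h"
    unfolding img r_coset_def by (auto simp: Fp p_add image_iff)
  finally have C': "C' = (F ` A') #>\<^bsub>?G\<^esub> ?p h" .
  have "D' = (\<lambda>x. ?p (r * x - h)) ` B"
    unfolding img D fB by (simp add: image_image mod_simps)
  also have "\<dots> = inv\<^bsub>?G\<^esub> ?p h <#\<^bsub>?G\<^esub> (F ` B')"
    unfolding img l_coset_def p_inv by (auto simp: Fp p_sub image_iff)
  finally have "equivalent_nf ?G (A', B') (C', D')"
    using F ph C' by (auto simp: equivalent_nf_def)
  then show ?thesis
    using pecher_phi_strongly_symmetric_nf[OF n \<open>odd n\<close>] assms(3,4) by (simp add: img)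
qed

end
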